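(* Let $G_3=\mathbb{R}\rtimes\mathbb{R}^+$ be the $ax+b$ group, with multiplication $(b,a)(b',a')=(b+ab',aa')$ for $b,b'\in\mathbb{R}$, $a,a'\in\mathbb{R}^+=(0,\infty)$, and let $N=\mathbb{R}\times\{1\}$, a closed normal subgroup of $G_3$. (1) If $f\in UCS(G_3)$, then $f$ is constant on each coset of $N$ in $G_3$. (2) $WS(G_3)=WAP(G_3/N)=WAP(\mathbb{R}^+)$, where a function $g$ on $G_3/N$ is identified with the function $g\circ\theta$ on $G_3$, $\theta:G_3\to G_3/N$ being the natural homomorphism, and $G_3/N$ is identified with the multiplicative group $\mathbb{R}^+$. That is, $WS(G_3)=\{g\circ\theta: g\in WAP(G_3/N)\}$.
   Context: For a locally compact group $G$, $C(G)$ denotes the $C^*$-algebra of bounded continuous complex-valued functions on $G$ with the sup norm. For $f\in C(G)$ and $x,y\in G$ put ${}_xf(z)=f(xz)$ and ${}_xf_y(z)=f(xzy)$; $O_L(f)=\{{}_xf:x\in G\}$ and $O(f)=\{{}_xf_y: x,y\in G\}$ (the double orbit). $WAP(G)$ is the set of $f\in C(G)$ with $O_L(f)$ relatively weakly compact in $C(G)$; $WS(G)$ is the set of $f\in C(G)$ with $O(f)$ relatively weakly compact in $C(G)$; $UCS(G)$ is the set of $f\in C(G)$ with $O(f)$ equicontinuous on $G$. *)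

theory Defs
  imports "HOL-Analysis.Analysis" "HOL-Algebra.Coset"
begin

text \<open>
  A topological group is a group \<open>G\<close> together with a topology \<open>T\<close> on \<open>carrier G\<close>.  This
  carrier-based form lets the same definitions apply to a group and to its quotient
  groups.  Local compactness includes the Hausdorff property.
\<close>

locale locally_compact_group = group G for G (structure) +
  fixes T :: "'a topology"
  assumes topspace_eq: "topspace T = carrier G"
    and continuous_mult: "continuous_map (prod_topology T T) T (\<lambda>(x, y). x \<otimes> y)"
    and continuous_inv: "continuous_map T T (\<lambda>x. inv x)"
    and Hausdorff: "Hausdorff_space T"
    and locally_compact: "locally_compact_space T"


section \<open>The space of bounded continuous functions and its weak topology\<close>

text \<open>
  Functions on the space are extensional (\<open>undefined\<close> off \<open>topspace T\<close>), so that equality of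
  functions is equality on the space; hence the restrictions in the definitions below.
\<close>

definition BC :: "'a topology \<Rightarrow> ('a \<Rightarrow> complex) set" where
  "BC T = {f \<in> extensional (topspace T).
             continuous_map T euclidean f \<and> bounded (f ` topspace T)}"

definition sup_norm :: "'a topology \<Rightarrow> ('a \<Rightarrow> complex) \<Rightarrow> real" where
  "sup_norm T f = (SUP x\<in>topspace T. norm (f x))"

text \<open>
  The dual consists of the bounded complex-linear functionals on \<open>BC T\<close>; their values outside
  \<open>BC T\<close> are irrelevant.
\<close>

definition BC_dual :: "'a topology \<Rightarrow> (('a \<Rightarrow> complex) \<Rightarrow> complex) set" where
  "BC_dual T = {\<phi>.
     (\<forall>f\<in>BC T. \<forall>g\<in>BC T. \<phi> (\<lambda>x\<in>topspace T. f x + g x) = \<phi> f + \<phi> g) \<and>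
     (\<forall>c. \<forall>f\<in>BC T. \<phi> (\<lambda>x\<in>topspace T. c * f x) = c * \<phi> f) \<and>
     (\<exists>K. \<forall>f\<in>BC T. norm (\<phi> f) \<le> K * sup_norm T f)}"

definition weak_topology :: "'a topology \<Rightarrow> ('a \<Rightarrow> complex) topology" where
  "weak_topology T =
     topology_generated_by {{f \<in> BC T. \<phi> f \<in> U} | \<phi> U. \<phi> \<in> BC_dual T \<and> open U}"

definition relatively_weakly_compact :: "'a topology \<Rightarrow> ('a \<Rightarrow> complex) set \<Rightarrow> bool" where
  "relatively_weakly_compact T S \<longleftrightarrow>
     S \<subseteq> BC T \<and> compactin (weak_topology T) (weak_topology T closure_of S)"

definition equicontinuous :: "'a topology \<Rightarrow> ('a \<Rightarrow> complex) set \<Rightarrow> bool" where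
  "equicontinuous T S \<longleftrightarrow>
     (\<forall>z\<in>topspace T. \<forall>\<epsilon>>0. \<exists>U. openin T U \<and> z \<in> U \<and>
        (\<forall>h\<in>S. \<forall>w\<in>U. norm (h w - h z) < \<epsilon>))"


section \<open>Orbits and the function spaces WAP, WS and UCS\<close>

definition left_orbit :: "('a, 'm) monoid_scheme \<Rightarrow> ('a \<Rightarrow> complex) \<Rightarrow> ('a \<Rightarrow> complex) set" where
  "left_orbit G f = {(\<lambda>z\<in>carrier G. f (x \<otimes>\<^bsub>G\<^esub> z)) | x. x \<in> carrier G}"

definition double_orbit :: "('a, 'm) monoid_scheme \<Rightarrow> ('a \<Rightarrow> complex) \<Rightarrow> ('a \<Rightarrow> complex) set" where
  "double_orbit G f =
     {(\<lambda>z\<in>carrier G. f (x \<otimes>\<^bsub>G\<^esub> z \<otimes>\<^bsub>G\<^esub> y)) | x y. x \<in> carrier G \<and> y \<in> carrier G}"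

definition WAP :: "('a, 'm) monoid_scheme \<Rightarrow> 'a topology \<Rightarrow> ('a \<Rightarrow> complex) set" where
  "WAP G T = {f \<in> BC T. relatively_weakly_compact T (left_orbit G f)}"

definition WS :: "('a, 'm) monoid_scheme \<Rightarrow> 'a topology \<Rightarrow> ('a \<Rightarrow> complex) set" where
  "WS G T = {f \<in> BC T. relatively_weakly_compact T (double_orbit G f)}"

definition UCS :: "('a, 'm) monoid_scheme \<Rightarrow> 'a topology \<Rightarrow> ('a \<Rightarrow> complex) set" where
  "UCS G T = {f \<in> BC T. equicontinuous T (double_orbit G f)}"


section \<open>Quotient groups\<close>

definition coset_map :: "('a, 'm) monoid_scheme \<Rightarrow> 'a set \<Rightarrow> 'a \<Rightarrow> 'a set" where
  "coset_map G H x = H #>\<^bsub>G\<^esub> x"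

definition quotient_topology :: "'a topology \<Rightarrow> ('a \<Rightarrow> 'b) \<Rightarrow> 'b topology" where
  "quotient_topology T q =
     topology (\<lambda>V. V \<subseteq> q ` topspace T \<and> openin T {x \<in> topspace T. q x \<in> V})"

text \<open>\<open>{g \<circ> q | g \<in> F}\<close>, as a set of (extensional) functions on \<open>A\<close>.\<close>

definition pullback_functions ::
  "'a set \<Rightarrow> ('a \<Rightarrow> 'b) \<Rightarrow> ('b \<Rightarrow> complex) set \<Rightarrow> ('a \<Rightarrow> complex) set" where
  "pullback_functions A q F = {compose A g q | g. g \<in> F}"

lemma istopology_quotient:
  "istopology (\<lambda>V. V \<subseteq> q ` topspace T \<and> openin T {x \<in> topspace T. q x \<in> V})"
  unfolding istopology_def
proof (intro conjI allI impI)
  fix S R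
  assume S: "S \<subseteq> q ` topspace T \<and> openin T {x \<in> topspace T. q x \<in> S}"
    and R: "R \<subseteq> q ` topspace T \<and> openin T {x \<in> topspace T. q x \<in> R}"
  show "S \<inter> R \<subseteq> q ` topspace T" using S by blast
  have "{x \<in> topspace T. q x \<in> S \<inter> R} = {x \<in> topspace T. q x \<in> S} \<inter> {x \<in> topspace T. q x \<in> R}"
    by blast
  then show "openin T {x \<in> topspace T. q x \<in> S \<inter> R}"
    using S R by (simp add: openin_Int)
next
  fix \<K>
  assume K: "\<forall>K\<in>\<K>. K \<subseteq> q ` topspace T \<and> openin T {x \<in> topspace T. q x \<in> K}"
  show "\<Union>\<K> \<subseteq> q ` topspace T" using K by blast
  have "{x \<in> topspace T. q x \<in> \<Union>\<K>} = (\<Union>K\<in>\<K>. {x \<in> topspace T. q x \<in> K})"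
    by blast
  moreover have "openin T (\<Union>K\<in>\<K>. {x \<in> topspace T. q x \<in> K})"
    using K by (intro openin_Union) auto
  ultimately show "openin T {x \<in> topspace T. q x \<in> \<Union>\<K>}"
    by simp
qed

lemma openin_quotient_topology:
  "openin (quotient_topology T q) V \<longleftrightarrow>
     V \<subseteq> q ` topspace T \<and> openin T {x \<in> topspace T. q x \<in> V}"
  unfolding quotient_topology_def by (simp add: istopology_quotient)

lemma topspace_quotient_topology: "topspace (quotient_topology T q) = q ` topspace T"
proof
  show "topspace (quotient_topology T q) \<subseteq> q ` topspace T"
    using openin_quotient_topology[of T q "topspace (quotient_topology T q)"] by simp
  have "{x \<in> topspace T. q x \<in> q ` topspace T} = topspace T" by blast
  then show "q ` topspace T \<subseteq> topspace (quotient_topology T q)"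
    by (intro openin_subset) (simp add: openin_quotient_topology)
qed

lemma quotient_map_quotient_topology: "quotient_map T (quotient_topology T q) q"
  by (auto simp: quotient_map_def topspace_quotient_topology openin_quotient_topology)


section \<open>The ax+b group, its normal subgroup N, and the positive reals\<close>

definition AXB :: "(real \<times> real) monoid" where
  "AXB = \<lparr>carrier = UNIV \<times> {0<..},
          mult = (\<lambda>(b, a) (b', a'). (b + a * b', a * a')),
          one = (0, 1)\<rparr>"

definition AXB_top :: "(real \<times> real) topology" where
  "AXB_top = top_of_set (UNIV \<times> {0<..})"

definition AXB_N :: "(real \<times> real) set" where
  "AXB_N = UNIV \<times> {1}"

definition Rpos :: "real monoid" where
  "Rpos = \<lparr>carrier = {0<..}, mult = (*), one = 1\<rparr>"

definition Rpos_top :: "real topology" where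
  "Rpos_top = top_of_set {0<..}"

definition AXB_quot :: "(real \<times> real) set monoid" where
  "AXB_quot = AXB Mod AXB_N"

definition AXB_quot_top :: "(real \<times> real) set topology" where
  "AXB_quot_top = quotient_topology AXB_top (coset_map AXB AXB_N)"

text \<open>
  The identification of the quotient with the positive reals: all elements of a coset have
  the same second coordinate.
\<close>

definition AXB_quot_to_Rpos :: "(real \<times> real) set \<Rightarrow> real" where
  "AXB_quot_to_Rpos K = the_elem (snd ` K)"

lemma AXB_simps [simp]:
  "carrier AXB = UNIV \<times> {0<..}"
  "(b, a) \<otimes>\<^bsub>AXB\<^esub> (b', a') = (b + a * b', a * a')"
  "\<one>\<^bsub>AXB\<^esub> = (0, 1)"
  by (simp_all add: AXB_def)

lemma Rpos_simps [simp]: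
  "carrier Rpos = {0<..}" "x \<otimes>\<^bsub>Rpos\<^esub> y = x * y" "\<one>\<^bsub>Rpos\<^esub> = 1"
  by (simp_all add: Rpos_def)

lemma group_AXB: "group AXB"
proof (rule groupI)
  fix x assume "x \<in> carrier AXB"
  then obtain b a where x: "x = (b, a)" "a > 0" by auto
  have "(- b / a, 1 / a) \<in> carrier AXB" "(- b / a, 1 / a) \<otimes>\<^bsub>AXB\<^esub> x = \<one>\<^bsub>AXB\<^esub>"
    using x by auto
  then show "\<exists>y\<in>carrier AXB. y \<otimes>\<^bsub>AXB\<^esub> x = \<one>\<^bsub>AXB\<^esub>" by blast
qed (auto simp: algebra_simps)

lemma inv_AXB: "a > 0 \<Longrightarrow> inv\<^bsub>AXB\<^esub> (b, a) = (- b / a, 1 / a)"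
  by (rule group.inv_equality[OF group_AXB]) auto

lemma group_Rpos: "group Rpos"
proof (rule groupI)
  fix x assume "x \<in> carrier Rpos"
  then have "1 / x \<in> carrier Rpos" "1 / x \<otimes>\<^bsub>Rpos\<^esub> x = \<one>\<^bsub>Rpos\<^esub>" by auto
  then show "\<exists>y\<in>carrier Rpos. y \<otimes>\<^bsub>Rpos\<^esub> x = \<one>\<^bsub>Rpos\<^esub>" by blast
qed auto

lemma inv_Rpos: "a > 0 \<Longrightarrow> inv\<^bsub>Rpos\<^esub> a = 1 / a"
  by (rule group.inv_equality[OF group_Rpos]) auto

lemma locally_compact_group_AXB: "locally_compact_group AXB AXB_top"
proof -
  interpret group AXB by (rule group_AXB)
  have op: "open (UNIV \<times> {0<..} :: (real \<times> real) set)" by (intro open_Times) auto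
  show ?thesis
  proof
    show "topspace AXB_top = carrier AXB" by (simp add: AXB_top_def)
    have "continuous_on ((UNIV \<times> {0<..}) \<times> (UNIV \<times> {0<..}))
            (\<lambda>p. (fst (fst p) + snd (fst p) * fst (snd p), snd (fst p) * snd (snd p)) :: real \<times> real)"
      by (intro continuous_intros)
    moreover have "(\<lambda>(x, y). x \<otimes>\<^bsub>AXB\<^esub> y) =
            (\<lambda>p. (fst (fst p) + snd (fst p) * fst (snd p), snd (fst p) * snd (snd p)))"
      by (auto simp: fun_eq_iff)
    ultimately show "continuous_map (prod_topology AXB_top AXB_top) AXB_top (\<lambda>(x, y). x \<otimes>\<^bsub>AXB\<^esub> y)"
      unfolding AXB_top_def
      by (auto simp flip: subtopology_Times simp: continuous_map_in_subtopology)
    have "continuous_on (UNIV \<times> {0<..}) (\<lambda>p. (- fst p / snd p, 1 / snd p) :: real \<times> real)"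
      by (intro continuous_intros) auto
    then have "continuous_map AXB_top AXB_top (\<lambda>p. (- fst p / snd p, 1 / snd p) :: real \<times> real)"
      unfolding AXB_top_def by (auto simp: continuous_map_in_subtopology)
    then show "continuous_map AXB_top AXB_top (\<lambda>x. inv\<^bsub>AXB\<^esub> x)"
      by (rule continuous_map_eq) (auto simp: AXB_top_def inv_AXB)
    show "Hausdorff_space AXB_top"
      unfolding AXB_top_def by (intro Hausdorff_space_subtopology) simp
    show "locally_compact_space AXB_top"
      unfolding AXB_top_def
      by (rule locally_compact_space_open_subset)
        (use op in \<open>auto intro: locally_compact_space_euclidean\<close>)
  qed
qed

lemma locally_compact_group_Rpos: "locally_compact_group Rpos Rpos_top"
proof -
  interpret group Rpos by (rule group_Rpos)
  show ?thesis
  proof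
    show "topspace Rpos_top = carrier Rpos" by (simp add: Rpos_top_def)
    have "continuous_on ({0<..} \<times> {0<..}) (\<lambda>(x, y). x * y :: real)"
      by (auto simp: split_def intro!: continuous_intros)
    then show "continuous_map (prod_topology Rpos_top Rpos_top) Rpos_top (\<lambda>(x, y). x \<otimes>\<^bsub>Rpos\<^esub> y)"
      unfolding Rpos_top_def
      by (auto simp flip: subtopology_Times simp: continuous_map_in_subtopology)
    have "continuous_on {0<..} (\<lambda>x::real. 1 / x)"
      by (intro continuous_intros) auto
    then have "continuous_map Rpos_top Rpos_top (\<lambda>x::real. 1 / x)"
      unfolding Rpos_top_def by (auto simp: continuous_map_in_subtopology)
    then show "continuous_map Rpos_top Rpos_top (\<lambda>x. inv\<^bsub>Rpos\<^esub> x)"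
      by (rule continuous_map_eq) (auto simp: Rpos_top_def inv_Rpos)
    show "Hausdorff_space Rpos_top"
      unfolding Rpos_top_def by (intro Hausdorff_space_subtopology) simp
    show "locally_compact_space Rpos_top"
      unfolding Rpos_top_def
      by (rule locally_compact_space_open_subset)
        (auto intro: locally_compact_space_euclidean)
  qed
qed

lemma closedin_AXB_N: "closedin AXB_top AXB_N"
  unfolding AXB_top_def AXB_N_def
  by (rule closed_subset) (auto intro: closed_Times)

lemma normal_AXB_N: "AXB_N \<lhd> AXB"
proof -
  interpret group AXB by (rule group_AXB)
  have "subgroup AXB_N AXB"
    by (rule subgroupI) (auto simp: AXB_N_def inv_AXB)
  moreover have "x \<otimes>\<^bsub>AXB\<^esub> h \<otimes>\<^bsub>AXB\<^esub> inv\<^bsub>AXB\<^esub> x \<in> AXB_N"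
    if "x \<in> carrier AXB" "h \<in> AXB_N" for x h
    using that by (auto simp: AXB_N_def inv_AXB)
  ultimately show ?thesis by (simp add: normal_inv_iff)
qed

lemma coset_map_AXB_N: "coset_map AXB AXB_N (b, a) = UNIV \<times> {a}"
proof -
  have "(c, a) \<in> (\<Union>h\<in>AXB_N. {h \<otimes>\<^bsub>AXB\<^esub> (b, a)})" for c
    by (rule UN_I[of "(c - b, 1)"]) (auto simp: AXB_N_def)
  then show ?thesis
    by (auto simp: coset_map_def r_coset_def AXB_N_def)
qed

lemma carrier_AXB_quot: "carrier AXB_quot = (\<lambda>a. UNIV \<times> {a}) ` {0<..}"
proof -
  have "carrier AXB_quot = coset_map AXB AXB_N ` carrier AXB"
    by (auto simp: AXB_quot_def FactGroup_def RCOSETS_def coset_map_def)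
  also have "\<dots> = (\<lambda>a. UNIV \<times> {a}) ` {0<..}"
    by (force simp: coset_map_AXB_N)
  finally show ?thesis .
qed

lemma AXB_quot_to_Rpos_eq: "AXB_quot_to_Rpos (UNIV \<times> {a}) = a"
  by (simp add: AXB_quot_to_Rpos_def)

lemma iso_AXB_quot_to_Rpos: "AXB_quot_to_Rpos \<in> iso AXB_quot Rpos"
proof -
  have m: "(UNIV \<times> {a}) \<otimes>\<^bsub>AXB_quot\<^esub> (UNIV \<times> {a'}) = UNIV \<times> {a * a'}"
    if "a > 0" "a' > 0" for a a'
  proof -
    interpret normal AXB_N AXB by (rule normal_AXB_N)
    have "(AXB_N #>\<^bsub>AXB\<^esub> (0, a)) <#>\<^bsub>AXB\<^esub> (AXB_N #>\<^bsub>AXB\<^esub> (0, a')) =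
            AXB_N #>\<^bsub>AXB\<^esub> ((0, a) \<otimes>\<^bsub>AXB\<^esub> (0, a'))"
      by (rule rcos_sum) (use that in auto)
    then show ?thesis
      by (simp add: AXB_quot_def FactGroup_def coset_map_AXB_N flip: coset_map_def)
  qed
  show ?thesis
    unfolding iso_def hom_def bij_betw_def inj_on_def
    by (auto simp: carrier_AXB_quot m AXB_quot_to_Rpos_eq image_image)
qed

lemma homeomorphic_map_AXB_quot_to_Rpos:
  "homeomorphic_map AXB_quot_top Rpos_top AXB_quot_to_Rpos"
proof -
  have top: "topspace AXB_quot_top = (\<lambda>a. UNIV \<times> {a}) ` {0<..}"
    by (force simp: AXB_quot_top_def topspace_quotient_topology AXB_top_def coset_map_AXB_N)
  have q: "quotient_map AXB_top AXB_quot_top (coset_map AXB AXB_N)"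
    unfolding AXB_quot_top_def by (rule quotient_map_quotient_topology)
  have comp: "AXB_quot_to_Rpos \<circ> coset_map AXB AXB_N = snd"
    by (auto simp: fun_eq_iff coset_map_AXB_N AXB_quot_to_Rpos_eq)
  have eq: "AXB_top = prod_topology euclidean Rpos_top"
    using subtopology_Times[of "euclidean :: real topology" "euclidean :: real topology" UNIV "{0<..}"]
    by (simp add: AXB_top_def Rpos_top_def)
  have "quotient_map AXB_top Rpos_top snd"
    unfolding eq by (simp add: quotient_map_snd)
  then have "quotient_map AXB_quot_top Rpos_top AXB_quot_to_Rpos"
    using quotient_map_compose_eq[OF q, of Rpos_top AXB_quot_to_Rpos] by (simp add: comp)
  then show ?thesis
    unfolding homeomorphic_map_def by (auto simp: top inj_on_def AXB_quot_to_Rpos_eq)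
qed

end

theory Submission
  imports Defs
begin

text \<open>
  Both parts rest on one observation about the ax+b group.  Left and right translation
  together turn a function \<open>f\<close> on the horizontal line \<open>\<real> \<times> {a}\<close> into
  \<open>u \<mapsto> f (d + t u, a)\<close> on the line \<open>\<real> \<times> {1}\<close>, for every \<open>d\<close> and
  every \<open>t > 0\<close>.  These affine maps carry any pair \<open>u < v\<close> onto any pair \<open>s < s'\<close>.  So if, for
  each \<open>\<epsilon>\<close>, there are two distinct points \<open>(u, 1)\<close>, \<open>(v, 1)\<close> such that the two values of
  every function in the double orbit are within \<open>\<epsilon>\<close> of each other, then \<open>f\<close> is constant on horizontal lines, which are the
  cosets of \<open>N\<close> (lemma \<open>constant_on_AXB_cosets\<close>).

  For \<open>f \<in> UCS\<close>, equicontinuity of the double orbit at the identity supplies such points.  For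
  \<open>f \<in> WS\<close> they come from weak compactness: a family of continuous functions on
  \<open>\<real>\<close> that is compact in a topology with continuous evaluations has uniformly small
  oscillation on some nonempty open set (lemma \<open>compact_family_small_oscillation\<close>).  This is an
  elementary case of Namioka's theorem on separate and joint continuity, proved by Baire category.

  Given this, the description of \<open>WS\<close> is formal.  Composition with a continuous homomorphism
  preserves \<open>WAP\<close> and \<open>WS\<close>, because composition operators are weakly continuous
  and carry orbits to orbits (\<open>WAP_pullback\<close>, \<open>WS_pullback\<close>).  On the abelian
  quotient \<open>WAP\<close> equals \<open>WS\<close>, so composition with the projection \<open>\<theta>\<close> maps
  \<open>WAP (G/N)\<close> into \<open>WS G\<close>.  Conversely the extension splits: with the quotient
  identified with the positive reals, \<open>\<sigma> a = (0, a)\<close> is a continuous homomorphism, and \<open>f \<in> WS G\<close>, being constant on cosets, equals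
  \<open>(f \<circ> \<sigma>) \<circ> \<theta>\<close> with \<open>f \<circ> \<sigma> \<in> WAP (G/N)\<close>.
\<close>

section \<open>Relative weak compactness\<close>

lemma BC_D:
  assumes "f \<in> BC T"
  shows BC_extensional: "f \<in> extensional (topspace T)"
    and BC_continuous: "continuous_map T euclidean f"
    and BC_bounded: "bounded (f ` topspace T)"
  using assms by (auto simp: BC_def)

lemma topspace_weak_topology: "topspace (weak_topology T) = BC T"
proof -
  have "(\<lambda>f. 0) \<in> BC_dual T"
    by (auto simp: BC_dual_def intro!: exI[of _ 0])
  then have "BC T \<in> {{f \<in> BC T. \<phi> f \<in> U} | \<phi> U. \<phi> \<in> BC_dual T \<and> open U}"
    by (intro CollectI exI[of _ "\<lambda>f. 0"] exI[of _ UNIV]) simp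
  then show ?thesis
    unfolding weak_topology_def topology_generated_by_topspace by blast
qed

lemma continuous_map_weak_dual:
  assumes "\<phi> \<in> BC_dual T"
  shows "continuous_map (weak_topology T) euclidean \<phi>"
proof -
  have "openin (weak_topology T) {f \<in> BC T. \<phi> f \<in> U}" if "open U" for U
    unfolding weak_topology_def
    by (rule topology_generated_by_Basis) (use assms that in auto)
  then show ?thesis
    unfolding continuous_map_def topspace_weak_topology by simp
qed

lemma norm_le_sup_norm:
  assumes "f \<in> BC T" "x \<in> topspace T"
  shows "norm (f x) \<le> sup_norm T f"
  unfolding sup_norm_def
proof (rule cSUP_upper[OF assms(2)])
  show "bdd_above ((\<lambda>x. norm (f x)) ` topspace T)"
    using BC_bounded[OF assms(1)] unfolding bounded_iff bdd_above_def by auto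
qed

lemma evaluation_in_BC_dual:
  assumes "x \<in> topspace T"
  shows "(\<lambda>f. f x) \<in> BC_dual T"
  unfolding BC_dual_def using assms norm_le_sup_norm[OF _ assms]
  by (auto intro!: exI[of _ 1])

lemma Hausdorff_weak_topology: "Hausdorff_space (weak_topology T)"
  unfolding Hausdorff_space_def
proof (intro allI impI, elim conjE)
  fix f g
  assume fg: "f \<in> topspace (weak_topology T)" "g \<in> topspace (weak_topology T)" "f \<noteq> g"
  then obtain x where x: "x \<in> topspace T" "f x \<noteq> g x"
    by (metis BC_extensional extensionalityI topspace_weak_topology)
  then obtain U V where UV: "open U" "open V" "f x \<in> U" "g x \<in> V" "U \<inter> V = {}"
    by (metis hausdorff)
  have "openin (weak_topology T) {h \<in> topspace (weak_topology T). h x \<in> A}" if "open A" for A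
    using continuous_map_weak_dual[OF evaluation_in_BC_dual[OF x(1)]] that
    by (simp add: continuous_map_def)
  then show "\<exists>U V. openin (weak_topology T) U \<and> openin (weak_topology T) V \<and>
      f \<in> U \<and> g \<in> V \<and> disjnt U V"
    using fg UV
    by (intro exI[of _ "{h \<in> topspace (weak_topology T). h x \<in> U}"]
        exI[of _ "{h \<in> topspace (weak_topology T). h x \<in> V}"]) (auto simp: disjnt_def)
qed

text \<open>
  The weak topology is Hausdorff, so a compact superset contains the closure as a closed subset.
  This form avoids computing closures when transporting relative weak compactness.
\<close>

lemma relatively_weakly_compact_iff:
  "relatively_weakly_compact T A \<longleftrightarrow> (\<exists>K. compactin (weak_topology T) K \<and> A \<subseteq> K)"
proof
  assume "relatively_weakly_compact T A"
  then show "\<exists>K. compactin (weak_topology T) K \<and> A \<subseteq> K"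
    unfolding relatively_weakly_compact_def
    by (metis closure_of_subset topspace_weak_topology)
next
  assume "\<exists>K. compactin (weak_topology T) K \<and> A \<subseteq> K"
  then obtain K where K: "compactin (weak_topology T) K" "A \<subseteq> K" by blast
  have "closedin (weak_topology T) K"
    by (rule compactin_imp_closedin[OF Hausdorff_weak_topology K(1)])
  then have "weak_topology T closure_of A \<subseteq> K"
    by (rule closure_of_minimal[OF K(2)])
  then have "compactin (weak_topology T) (weak_topology T closure_of A)"
    by (rule closed_compactin[OF K(1)]) simp
  then show "relatively_weakly_compact T A"
    using K compactin_subset_topspace[OF K(1)]
    by (auto simp: relatively_weakly_compact_def topspace_weak_topology)
qed

lemma relatively_weakly_compact_subset:
  "relatively_weakly_compact T A \<Longrightarrow> B \<subseteq> A \<Longrightarrow> relatively_weakly_compact T B"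
  unfolding relatively_weakly_compact_iff by blast

lemma pullback_in_BC:
  assumes q: "continuous_map S T q" and f: "f \<in> BC T"
  shows "compose (topspace S) f q \<in> BC S"
proof -
  have "q ` topspace S \<subseteq> topspace T"
    using q by (rule continuous_map_image_subset_topspace)
  then have "bounded (compose (topspace S) f q ` topspace S)"
    by (intro bounded_subset[OF BC_bounded[OF f]]) (auto simp: compose_def)
  moreover have "continuous_map S euclidean (compose (topspace S) f q)"
    by (rule continuous_map_eq[OF continuous_map_compose[OF q BC_continuous[OF f]]])
      (auto simp: compose_def)
  ultimately show ?thesis
    by (auto simp: BC_def)
qed

text \<open>
  Composition with \<open>q\<close> is a linear operator of norm at most 1; this is its transpose on
  functionals.  On the empty space the supremum norm is an unspecified real number, which is why
  \<open>S\<close> has to be nonempty.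
\<close>

lemma dual_pullback:
  assumes q: "continuous_map S T q" and ne: "topspace S \<noteq> {}" and \<phi>: "\<phi> \<in> BC_dual S"
  shows "(\<lambda>f. \<phi> (compose (topspace S) f q)) \<in> BC_dual T"
proof -
  let ?q = "\<lambda>f. compose (topspace S) f q"
  have qT: "q x \<in> topspace T" if "x \<in> topspace S" for x
    using q that by (auto simp: continuous_map_def)
  have add: "?q (\<lambda>x\<in>topspace T. f x + g x) = (\<lambda>x\<in>topspace S. ?q f x + ?q g x)" for f g
    using qT by (auto simp: compose_def fun_eq_iff)
  have mult: "?q (\<lambda>x\<in>topspace T. c * f x) = (\<lambda>x\<in>topspace S. c * ?q f x)" for c f
    using qT by (auto simp: compose_def fun_eq_iff)
  obtain K where K: "\<And>f. f \<in> BC S \<Longrightarrow> norm (\<phi> f) \<le> K * sup_norm S f"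
    using \<phi> unfolding BC_dual_def by blast
  have "norm (\<phi> (?q f)) \<le> \<bar>K\<bar> * sup_norm T f" if f: "f \<in> BC T" for f
  proof -
    \<comment> \<open>The constant \<open>K\<close> may be negative, so the norm comparison needs \<open>\<bar>K\<bar>\<close>.\<close>
    have le: "sup_norm S (?q f) \<le> sup_norm T f"
      unfolding sup_norm_def[of S]
      by (rule cSUP_least[OF ne]) (use qT norm_le_sup_norm[OF f] in \<open>auto simp: compose_def\<close>)
    obtain x where "x \<in> topspace S" using ne by blast
    then have "0 \<le> sup_norm S (?q f)"
      using norm_le_sup_norm[OF pullback_in_BC[OF q f]] norm_ge_zero order_trans by blast
    then have "K * sup_norm S (?q f) \<le> \<bar>K\<bar> * sup_norm T f"
      by (intro mult_mono le) auto
    then show ?thesis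
      using K[OF pullback_in_BC[OF q f]] by linarith
  qed
  moreover have "\<phi> (?q (\<lambda>x\<in>topspace T. f x + g x)) = \<phi> (?q f) + \<phi> (?q g)"
    if "f \<in> BC T" "g \<in> BC T" for f g
    unfolding add using \<phi> that[THEN pullback_in_BC[OF q]] unfolding BC_dual_def by blast
  moreover have "\<phi> (?q (\<lambda>x\<in>topspace T. c * f x)) = c * \<phi> (?q f)" if "f \<in> BC T" for c f
    unfolding mult using \<phi> that[THEN pullback_in_BC[OF q]] unfolding BC_dual_def by blast
  ultimately show ?thesis
    unfolding BC_dual_def by blast
qed

lemma continuous_map_weak_pullback:
  assumes q: "continuous_map S T q" and ne: "topspace S \<noteq> {}"
  shows "continuous_map (weak_topology T) (weak_topology S) (\<lambda>f. compose (topspace S) f q)"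
proof -
  let ?q = "\<lambda>f. compose (topspace S) f q"
  have "openin (weak_topology T) (?q -` {f \<in> BC S. \<phi> f \<in> U} \<inter> topspace (weak_topology T))"
    if "\<phi> \<in> BC_dual S" "open U" for \<phi> U
  proof -
    have "?q -` {f \<in> BC S. \<phi> f \<in> U} \<inter> topspace (weak_topology T) =
        {f \<in> topspace (weak_topology T). \<phi> (?q f) \<in> U}"
      using pullback_in_BC[OF q] by (auto simp: topspace_weak_topology)
    then show ?thesis
      using continuous_map_weak_dual[OF dual_pullback[OF q ne that(1)]] that(2)
      by (simp add: continuous_map_def)
  qed
  then have pre: "openin (weak_topology T) (?q -` X \<inter> topspace (weak_topology T))"
    if "X \<in> {{f \<in> BC S. \<phi> f \<in> U} | \<phi> U. \<phi> \<in> BC_dual S \<and> open U}" for X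
    using that by blast
  have Un: "\<Union>{{f \<in> BC S. \<phi> f \<in> U} | \<phi> U. \<phi> \<in> BC_dual S \<and> open U} = BC S"
    using topspace_weak_topology[of S]
    unfolding weak_topology_def topology_generated_by_topspace .
  have im: "?q ` topspace (weak_topology T) \<subseteq>
      \<Union>{{f \<in> BC S. \<phi> f \<in> U} | \<phi> U. \<phi> \<in> BC_dual S \<and> open U}"
    unfolding Un topspace_weak_topology using pullback_in_BC[OF q] by blast
  show ?thesis
    unfolding weak_topology_def[of S]
    by (rule continuous_on_generated_topo) (rule pre, assumption, rule im)
qed

lemma relatively_weakly_compact_pullback:
  assumes "continuous_map S T q" "topspace S \<noteq> {}" "relatively_weakly_compact T A"
  shows "relatively_weakly_compact S ((\<lambda>f. compose (topspace S) f q) ` A)"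
proof -
  obtain K where K: "compactin (weak_topology T) K" "A \<subseteq> K"
    using assms(3) unfolding relatively_weakly_compact_iff by blast
  have "compactin (weak_topology S) ((\<lambda>f. compose (topspace S) f q) ` K)"
    by (rule image_compactin[OF K(1) continuous_map_weak_pullback[OF assms(1,2)]])
  then show ?thesis
    unfolding relatively_weakly_compact_iff using image_mono[OF K(2)]
    by (intro exI conjI) assumption+
qed


section \<open>Functoriality of WAP and WS\<close>

text \<open>
  Translating \<open>f \<circ> q\<close> by \<open>x\<close> is the same as translating \<open>f\<close> by \<open>q x\<close> and then composing
  with \<open>q\<close>.  The inclusions may be strict, since \<open>q\<close> need not be surjective.
\<close>

lemma left_orbit_pullback:
  assumes "group G" "q \<in> hom G H"
  shows "left_orbit G (compose (carrier G) f q) \<subseteq>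
    (\<lambda>h. compose (carrier G) h q) ` left_orbit H f"
proof
  interpret group G by fact
  fix k assume "k \<in> left_orbit G (compose (carrier G) f q)"
  then obtain x where x: "x \<in> carrier G"
    and k: "k = (\<lambda>z\<in>carrier G. compose (carrier G) f q (x \<otimes>\<^bsub>G\<^esub> z))"
    unfolding left_orbit_def by blast
  have "k = compose (carrier G) (\<lambda>w\<in>carrier H. f (q x \<otimes>\<^bsub>H\<^esub> w)) q"
    using assms(2) x by (auto simp: k compose_def fun_eq_iff hom_mult hom_in_carrier)
  then show "k \<in> (\<lambda>h. compose (carrier G) h q) ` left_orbit H f"
    using x hom_in_carrier[OF assms(2)] unfolding left_orbit_def by blast
qed

lemma double_orbit_pullback:
  assumes "group G" "q \<in> hom G H"
  shows "double_orbit G (compose (carrier G) f q) \<subseteq>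
    (\<lambda>h. compose (carrier G) h q) ` double_orbit H f"
proof
  interpret group G by fact
  fix k assume "k \<in> double_orbit G (compose (carrier G) f q)"
  then obtain x y where xy: "x \<in> carrier G" "y \<in> carrier G"
    and k: "k = (\<lambda>z\<in>carrier G. compose (carrier G) f q (x \<otimes>\<^bsub>G\<^esub> z \<otimes>\<^bsub>G\<^esub> y))"
    unfolding double_orbit_def by blast
  have "k = compose (carrier G) (\<lambda>w\<in>carrier H. f (q x \<otimes>\<^bsub>H\<^esub> w \<otimes>\<^bsub>H\<^esub> q y)) q"
    using assms(2) xy by (auto simp: k compose_def fun_eq_iff hom_mult hom_in_carrier)
  then show "k \<in> (\<lambda>h. compose (carrier G) h q) ` double_orbit H f"
    using xy hom_in_carrier[OF assms(2)] unfolding double_orbit_def by blast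
qed

lemma WAP_pullback:
  assumes "group G" "topspace S = carrier G" "q \<in> hom G H" "continuous_map S T q"
    and "f \<in> WAP H T"
  shows "compose (carrier G) f q \<in> WAP G S"
proof -
  have "topspace S \<noteq> {}"
    using assms(1,2) group.is_monoid monoid.one_closed by blast
  then have "relatively_weakly_compact S ((\<lambda>h. compose (carrier G) h q) ` left_orbit H f)"
    using relatively_weakly_compact_pullback[OF assms(4)] assms(2,5) by (simp add: WAP_def)
  then have "relatively_weakly_compact S (left_orbit G (compose (carrier G) f q))"
    by (rule relatively_weakly_compact_subset) (rule left_orbit_pullback[OF assms(1,3)])
  then show ?thesis
    using pullback_in_BC[OF assms(4)] assms(2,5) by (simp add: WAP_def)
qed

lemma WS_pullback:
  assumes "group G" "topspace S = carrier G" "q \<in> hom G H" "continuous_map S T q"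
    and "f \<in> WS H T"
  shows "compose (carrier G) f q \<in> WS G S"
proof -
  have "topspace S \<noteq> {}"
    using assms(1,2) group.is_monoid monoid.one_closed by blast
  then have "relatively_weakly_compact S ((\<lambda>h. compose (carrier G) h q) ` double_orbit H f)"
    using relatively_weakly_compact_pullback[OF assms(4)] assms(2,5) by (simp add: WS_def)
  then have "relatively_weakly_compact S (double_orbit G (compose (carrier G) f q))"
    by (rule relatively_weakly_compact_subset) (rule double_orbit_pullback[OF assms(1,3)])
  then show ?thesis
    using pullback_in_BC[OF assms(4)] assms(2,5) by (simp add: WS_def)
qed

lemma WAP_iso:
  assumes G: "group G" "topspace S = carrier G" and H: "group H" "topspace T = carrier H"
    and q: "q \<in> iso G H" "homeomorphic_map S T q"
  shows "WAP G S = pullback_functions (carrier G) q (WAP H T)"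
proof
  have qhom: "q \<in> hom G H"
    using q(1) by (auto simp: iso_def)
  have qcont: "continuous_map S T q"
    using q(2) by (rule homeomorphic_imp_continuous_map)
  show "pullback_functions (carrier G) q (WAP H T) \<subseteq> WAP G S"
    using WAP_pullback[OF G qhom qcont] by (auto simp: pullback_functions_def)
  obtain p where p: "homeomorphic_maps S T q p"
    using q(2) by (auto simp: homeomorphic_map_maps)
  then have pcont: "continuous_map T S p" and pq: "\<And>x. x \<in> carrier G \<Longrightarrow> p (q x) = x"
    and qp: "\<And>y. y \<in> carrier H \<Longrightarrow> q (p y) = y"
    using G H by (auto simp: homeomorphic_maps_def)
  have pcl: "p y \<in> carrier G" if "y \<in> carrier H" for y
    using pcont that G H by (auto simp: continuous_map_def)
  have "p \<in> hom H G"
  proof (rule homI)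
    fix x y assume xy: "x \<in> carrier H" "y \<in> carrier H"
    have "x \<otimes>\<^bsub>H\<^esub> y = q (p x \<otimes>\<^bsub>G\<^esub> p y)"
      using xy pcl qp hom_mult[OF qhom] by simp
    then show "p (x \<otimes>\<^bsub>H\<^esub> y) = p x \<otimes>\<^bsub>G\<^esub> p y"
      using xy pcl pq G(1) by (simp add: group.is_monoid monoid.m_closed)
  qed (rule pcl)
  show "WAP G S \<subseteq> pullback_functions (carrier G) q (WAP H T)"
  proof
    fix f assume f: "f \<in> WAP G S"
    have "f \<in> extensional (carrier G)"
      using f G(2) by (auto simp: WAP_def dest: BC_extensional)
    then have "f = compose (carrier G) (compose (carrier H) f p) q"
      using pq hom_in_carrier[OF qhom] by (auto simp: compose_def fun_eq_iff extensional_def)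
    moreover have "compose (carrier H) f p \<in> WAP H T"
      by (rule WAP_pullback[OF H \<open>p \<in> hom H G\<close> pcont f])
    ultimately show "f \<in> pullback_functions (carrier G) q (WAP H T)"
      unfolding pullback_functions_def by blast
  qed
qed

lemma left_orbit_subset_double_orbit:
  assumes "group G"
  shows "left_orbit G f \<subseteq> double_orbit G f"
proof
  interpret group G by fact
  fix k assume "k \<in> left_orbit G f"
  then obtain x where x: "x \<in> carrier G" and k: "k = (\<lambda>z\<in>carrier G. f (x \<otimes>\<^bsub>G\<^esub> z))"
    unfolding left_orbit_def by blast
  have "k = (\<lambda>z\<in>carrier G. f (x \<otimes>\<^bsub>G\<^esub> z \<otimes>\<^bsub>G\<^esub> \<one>\<^bsub>G\<^esub>))"
    using x by (auto simp: k fun_eq_iff)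
  then show "k \<in> double_orbit G f"
    using x unfolding double_orbit_def by blast
qed

lemma WS_subset_WAP:
  assumes "group G"
  shows "WS G T \<subseteq> WAP G T"
  unfolding WS_def WAP_def
  using relatively_weakly_compact_subset[OF _ left_orbit_subset_double_orbit[OF assms]] by blast

lemma WS_eq_WAP_if_comm:
  assumes "comm_group G"
  shows "WS G T = WAP G T"
proof -
  interpret comm_group G by fact
  have "double_orbit G f \<subseteq> left_orbit G f" for f
  proof
    fix k assume "k \<in> double_orbit G f"
    then obtain x y where xy: "x \<in> carrier G" "y \<in> carrier G"
      and k: "k = (\<lambda>z\<in>carrier G. f (x \<otimes>\<^bsub>G\<^esub> z \<otimes>\<^bsub>G\<^esub> y))"
      unfolding double_orbit_def by blast
    have "k = (\<lambda>z\<in>carrier G. f ((x \<otimes>\<^bsub>G\<^esub> y) \<otimes>\<^bsub>G\<^esub> z))"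
      using xy by (auto simp: k fun_eq_iff m_ac)
    then show "k \<in> left_orbit G f"
      using xy unfolding left_orbit_def by blast
  qed
  then have "double_orbit G f = left_orbit G f" for f
    using left_orbit_subset_double_orbit[OF is_group] by blast
  then show ?thesis
    by (simp add: WS_def WAP_def)
qed


section \<open>Compact families of continuous functions\<close>

text \<open>
  Choose a dense sequence \<open>d\<close>.  Two members of \<open>K\<close> that agree on \<open>d\<close> agree everywhere, so by
  compactness of \<open>K \<times> K\<close>, for each point \<open>x\<close> there is an \<open>n\<close> such that being
  \<open>1/n\<close>-close at \<open>d 0, \<dots>, d (n - 1)\<close> forces being \<open>\<eta>\<close>-close at \<open>x\<close>.  The sets \<open>E n\<close>
  of points for which \<open>n\<close> works are closed and cover the space; by Baire, one of them has interior.
  There \<open>K\<close> is uniformly approximated by finitely many of its members, and finitely many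
  continuous functions have a common neighbourhood on which they vary little.
\<close>

lemma compact_family_small_oscillation:
  fixes ev :: "'k \<Rightarrow> 'b::euclidean_space \<Rightarrow> 'c::real_normed_vector"
  assumes K: "compactin W K"
    and ev: "\<And>x. continuous_map W euclidean (\<lambda>h. ev h x)"
    and cont: "\<And>h. h \<in> K \<Longrightarrow> continuous_on UNIV (ev h)"
    and "\<epsilon> > 0"
  shows "\<exists>U. open U \<and> U \<noteq> {} \<and>
    (\<forall>h\<in>K. \<forall>u\<in>U. \<forall>v\<in>U. norm (ev h u - ev h v) < \<epsilon>)"
proof -
  \<comment> \<open>The final estimate uses four errors of size at most \<open>\<eta>\<close>.\<close>
  define \<eta> where "\<eta> = \<epsilon> / 5"
  have "\<eta> > 0" "\<epsilon> = 5 * \<eta>"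
    using \<open>\<epsilon> > 0\<close> by (simp_all add: \<eta>_def)
  obtain D :: "'b set" where D: "countable D" "\<And>X. open X \<Longrightarrow> X \<noteq> {} \<Longrightarrow> \<exists>d\<in>D. d \<in> X"
    by (rule countable_dense_setE) blast
  have Dne: "D \<noteq> {}" using D(2)[of UNIV] by auto
  define d where "d = from_nat_into D"
  have d: "range d = D"
    unfolding d_def using range_from_nat_into[OF Dne D(1)] .
  define close where "close n h k \<longleftrightarrow> (\<forall>i<n. norm (ev h (d i) - ev k (d i)) \<le> 1 / real n)"
    for n h k
  define E where "E n = {x. \<forall>h\<in>K. \<forall>k\<in>K. close n h k \<longrightarrow> norm (ev h x - ev k x) \<le> \<eta>}" for n
  have E_closed: "closed (E n)" for n
  proof -
    have "E n = (\<Inter>h\<in>K. \<Inter>k\<in>{k\<in>K. close n h k}. {x. norm (ev h x - ev k x) \<le> \<eta>})"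
      by (auto simp: E_def)
    then show ?thesis
      using cont by (auto intro!: closed_INT closed_Collect_le continuous_intros)
  qed
  have E_cover: "\<exists>n. x \<in> E n" for x
  proof -
    \<comment> \<open>\<open>V n\<close> consists of the pairs that do not witness \<open>x \<notin> E n\<close>.\<close>
    define V where "V n = {(h, k) \<in> topspace (prod_topology W W).
        \<not> close n h k \<or> norm (ev h x - ev k x) < \<eta>}" for n
    have diff: "continuous_map (prod_topology W W) euclideanreal
        (\<lambda>p. norm (ev (fst p) y - ev (snd p) y))" for y
    proof -
      have "continuous_map (prod_topology W W) euclidean (\<lambda>p. ev (fst p) y)"
        "continuous_map (prod_topology W W) euclidean (\<lambda>p. ev (snd p) y)"
        using continuous_map_compose[OF continuous_map_fst ev[of y]]
          continuous_map_compose[OF continuous_map_snd ev[of y]] by (simp_all add: o_def)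
      then show ?thesis
        by (intro continuous_intros)
    qed
    have diff_gt: "openin (prod_topology W W) {p \<in> topspace (prod_topology W W).
        c < norm (ev (fst p) y - ev (snd p) y)}" for c y
      using openin_continuous_map_preimage[OF diff, of "{c<..}" y]
      by (simp del: topspace_prod_topology)
    have diff_lt: "openin (prod_topology W W) {p \<in> topspace (prod_topology W W).
        norm (ev (fst p) y - ev (snd p) y) < c}" for c y
      using openin_continuous_map_preimage[OF diff, of "{..<c}" y]
      by (simp del: topspace_prod_topology)
    have V_open: "openin (prod_topology W W) (V n)" for n
    proof -
      have V_eq: "V n = (\<Union>i<n. {p \<in> topspace (prod_topology W W).
            1 / real n < norm (ev (fst p) (d i) - ev (snd p) (d i))}) \<union>
          {p \<in> topspace (prod_topology W W). norm (ev (fst p) x - ev (snd p) x) < \<eta>}"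
        by (auto simp: V_def close_def not_le)
      show ?thesis
        unfolding V_eq by (intro openin_Un diff_lt openin_Union) (use diff_gt in blast)
    qed
    have V_mono: "V m \<subseteq> V n" if "m \<le> n" for m n
    proof -
      have "close m h k" if *: "close n h k" for h k
        unfolding close_def
      proof (intro allI impI)
        fix i assume "i < m"
        then have "norm (ev h (d i) - ev k (d i)) \<le> 1 / real n"
          using * \<open>m \<le> n\<close> by (simp add: close_def)
        also have "\<dots> \<le> 1 / real m"
          using \<open>i < m\<close> \<open>m \<le> n\<close> by (intro divide_left_mono) auto
        finally show "norm (ev h (d i) - ev k (d i)) \<le> 1 / real m" .
      qed
      then show ?thesis
        unfolding V_def by blast
    qed
    have "K \<times> K \<subseteq> (\<Union>n. V n)"
    proof clarify
      fix h k assume hk: "h \<in> K" "k \<in> K"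
      have "(h, k) \<in> topspace (prod_topology W W)"
        using hk compactin_subset_topspace[OF K] by auto
      moreover have "\<exists>n. \<not> close n h k" if "norm (ev h x - ev k x) \<ge> \<eta>"
      proof -
        have "open {y. 0 < norm (ev h y - ev k y)}"
          using cont hk by (intro open_Collect_less continuous_intros) auto
        moreover have "x \<in> {y. 0 < norm (ev h y - ev k y)}"
          using that \<open>\<eta> > 0\<close> by (auto intro: less_le_trans)
        ultimately obtain i where i: "0 < norm (ev h (d i) - ev k (d i))"
          using D(2)[of "{y. 0 < norm (ev h y - ev k y)}"] d by blast
        obtain N where N: "N > 0" "1 / real N < norm (ev h (d i) - ev k (d i))"
          using ex_inverse_of_nat_less[OF i] by (auto simp: inverse_eq_divide)
        have "1 / real (max N (Suc i)) \<le> 1 / real N"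
          using N(1) by (simp add: frac_le)
        then have "\<not> close (max N (Suc i)) h k"
          using N unfolding close_def
          by (auto simp: not_le intro!: exI[of _ i])
        then show ?thesis ..
      qed
      ultimately have "\<exists>n. (h, k) \<in> V n"
        unfolding V_def by (cases "norm (ev h x - ev k x) < \<eta>") auto
      then show "(h, k) \<in> (\<Union>n. V n)" by blast
    qed
    moreover have "compactin (prod_topology W W) (K \<times> K)"
      using K by (simp add: compactin_Times)
    ultimately have "\<exists>\<F>. finite \<F> \<and> \<F> \<subseteq> range V \<and> K \<times> K \<subseteq> \<Union>\<F>"
      by (intro compactinD) (use V_open in auto)
    then obtain \<F> where \<F>: "finite \<F>" "\<F> \<subseteq> range V" "K \<times> K \<subseteq> \<Union>\<F>"
      by (elim exE conjE)
    then obtain I where I: "finite I" "\<F> = V ` I"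
      using finite_subset_image[OF \<F>(1,2)] by blast
    define N where "N = Max (insert 0 I)"
    have "V i \<subseteq> V N" if "i \<in> I" for i
      using that I(1) by (intro V_mono) (simp add: N_def)
    then have KV: "K \<times> K \<subseteq> V N"
      using \<F>(3) I(2) by blast
    have "norm (ev h x - ev k x) \<le> \<eta>" if "h \<in> K" "k \<in> K" "close N h k" for h k
    proof -
      have "(h, k) \<in> V N" using KV that by blast
      then show ?thesis using that(3) by (simp add: V_def)
    qed
    then show ?thesis
      unfolding E_def by blast
  qed
  obtain n where n: "interior (E n) \<noteq> {}"
  proof (rule ccontr)
    assume "\<not> thesis"
    then have "interior (E n) = {}" for n using that by blast
    then have "UNIV \<subseteq> closure (\<Inter> (range (\<lambda>n. - E n)))"
      using E_closed by (intro Baire) (auto simp: closure_complement open_Compl)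
    moreover have "\<Inter> (range (\<lambda>n. - E n)) = {}"
      using E_cover by blast
    ultimately show False by auto
  qed
  obtain F where F: "finite F" "F \<subseteq> K" "\<And>h. h \<in> K \<Longrightarrow> \<exists>k\<in>F. close n h k"
  proof -
    define V where "V k = {h \<in> topspace W. \<forall>i<n. ev h (d i) \<in> ball (ev k (d i)) (1 / real n)}"
      for k
    have V_open: "openin W (V k)" for k
    proof -
      have "V k = topspace W \<inter>
          (\<Inter>i\<in>{..<n}. {h \<in> topspace W. ev h (d i) \<in> ball (ev k (d i)) (1 / real n)})"
        by (auto simp: V_def)
      moreover have "openin W {h \<in> topspace W. ev h (d i) \<in> ball (ev k (d i)) (1 / real n)}" for i
        using openin_continuous_map_preimage[OF ev, of "ball (ev k (d i)) (1 / real n)" "d i"]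
        by simp
      ultimately show ?thesis
        by (cases "n = 0") (auto intro!: openin_Int openin_INT)
    qed
    have "k \<in> V k" if "k \<in> K" for k
      using that compactin_subset_topspace[OF K] by (auto simp: V_def)
    then have "K \<subseteq> \<Union>(V ` K)" by blast
    then have "\<exists>\<F>. finite \<F> \<and> \<F> \<subseteq> V ` K \<and> K \<subseteq> \<Union>\<F>"
      by (intro compactinD[OF K]) (use V_open in auto)
    then obtain \<F> where \<F>: "finite \<F>" "\<F> \<subseteq> V ` K" "K \<subseteq> \<Union>\<F>"
      by (elim exE conjE)
    then obtain F where F: "finite F" "F \<subseteq> K" "K \<subseteq> \<Union>(V ` F)"
      using finite_subset_image[OF \<F>(1,2)] by blast
    have "close n h k" if "h \<in> V k" for h k
      using that by (auto simp: V_def close_def dist_norm norm_minus_commute less_imp_le)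
    then show thesis
      using F by (intro that[of F]) blast+
  qed
  obtain u0 where u0: "u0 \<in> interior (E n)" using n by blast
  define U where "U = interior (E n) \<inter> (\<Inter>k\<in>F. {u. norm (ev k u - ev k u0) < \<eta>})"
  show ?thesis
  proof (intro exI[of _ U] conjI ballI)
    show "open U"
      unfolding U_def using F(1,2) cont
      by (intro open_Int open_interior open_INT ballI open_Collect_less continuous_intros) auto
    show "U \<noteq> {}"
      using u0 \<open>\<eta> > 0\<close> by (auto simp: U_def)
    fix h u v assume h: "h \<in> K" and uv: "u \<in> U" "v \<in> U"
    obtain k where k: "k \<in> F" "close n h k" using F(3)[OF h] by blast
    have hk: "norm (ev h w - ev k w) \<le> \<eta>" if "w \<in> U" for w
      using that h k F(2) interior_subset[of "E n"] by (auto simp: U_def E_def)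
    have ku: "norm (ev k w - ev k u0) < \<eta>" if "w \<in> U" for w
      using that k by (auto simp: U_def)
    have "ev h u - ev h v = (ev h u - ev k u) - (ev h v - ev k v) +
        ((ev k u - ev k u0) - (ev k v - ev k u0))" by simp
    also have "norm \<dots> \<le> (norm (ev h u - ev k u) + norm (ev h v - ev k v)) +
        (norm (ev k u - ev k u0) + norm (ev k v - ev k u0))"
      by (intro norm_triangle_le add_mono norm_triangle_ineq4)
    also have "\<dots> < \<epsilon>"
      using hk[OF uv(1)] hk[OF uv(2)] ku[OF uv(1)] ku[OF uv(2)] \<open>\<epsilon> = 5 * \<eta>\<close> \<open>\<eta> > 0\<close>
        by linarith
    finally show "norm (ev h u - ev h v) < \<epsilon>" .
  qed
qed

section \<open>The ax+b group\<close>

text \<open>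
  The two-sided translates of \<open>f\<close> include \<open>u \<mapsto> f (d + t u, a)\<close> with arbitrary \<open>d\<close> and
  \<open>t > 0\<close>, so smallness of the whole double orbit at one pair of points is smallness of \<open>f\<close>
  at every pair of points on a horizontal line.
\<close>

lemma constant_on_AXB_cosets:
  assumes osc: "\<And>\<epsilon>. \<epsilon> > 0 \<Longrightarrow> \<exists>u v. u \<noteq> v \<and>
      (\<forall>h\<in>double_orbit AXB f. norm (h (u, 1) - h (v, 1)) < \<epsilon>)"
    and "a > 0"
  shows "f (s, a) = f (s', a)"
proof -
  have *: "f (s, a) = f (s', a)" if "s < s'" for s s'
  proof (rule ccontr)
    assume ne: "f (s, a) \<noteq> f (s', a)"
    then obtain u v where "u \<noteq> v"
      and uv: "\<And>h. h \<in> double_orbit AXB f \<Longrightarrow>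
        norm (h (u, 1) - h (v, 1)) < norm (f (s, a) - f (s', a))"
      using osc[of "norm (f (s, a) - f (s', a))"] by auto
    \<comment> \<open>The hypothesis is symmetric in \<open>u\<close> and \<open>v\<close>.\<close>
    obtain u v where "u < v"
      and uv: "\<And>h. h \<in> double_orbit AXB f \<Longrightarrow>
        norm (h (u, 1) - h (v, 1)) < norm (f (s, a) - f (s', a))"
    proof (cases "u < v")
      case True
      then show ?thesis using uv that by blast
    next
      case False
      then have "v < u" using \<open>u \<noteq> v\<close> by simp
      then show ?thesis using uv that[of v u] by (simp add: norm_minus_commute)
    qed
    \<comment> \<open>The translation by \<open>x\<close> and \<open>y\<close> maps \<open>(u, 1)\<close> to \<open>(s, a)\<close> and \<open>(v, 1)\<close> to \<open>(s', a)\<close>;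
      the dilation factor \<open>t\<close> is positive because both pairs are in increasing order.\<close>
    define t where "t = (s' - s) / (v - u)"
    define x where "x = (s - t * u, t)"
    define y where "y = (0 :: real, a / t)"
    have t: "t > 0" using \<open>s < s'\<close> \<open>u < v\<close> by (simp add: t_def)
    have "t * (v - u) = s' - s" using \<open>u < v\<close> by (simp add: t_def)
    then have tv: "s - t * u + t * v = s'" by (simp add: algebra_simps)
    define h where "h = (\<lambda>z\<in>carrier AXB. f (x \<otimes>\<^bsub>AXB\<^esub> z \<otimes>\<^bsub>AXB\<^esub> y))"
    have "h \<in> double_orbit AXB f"
      using t \<open>a > 0\<close> unfolding double_orbit_def h_def by (force simp: x_def y_def)
    moreover have "h (u, 1) = f (s, a)" "h (v, 1) = f (s', a)"
      using t tv by (simp_all add: h_def x_def y_def)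
    ultimately show False using uv[of h] by simp
  qed
  show ?thesis
    using *[of s s'] *[of s' s] less_linear[of s s'] by metis
qed

lemma UCS_AXB_constant:
  assumes f: "f \<in> UCS AXB AXB_top" and "a > 0"
  shows "f (s, a) = f (s', a)"
proof (rule constant_on_AXB_cosets[OF _ \<open>a > 0\<close>])
  fix \<epsilon> :: real assume "\<epsilon> > 0"
  have "(0, 1) \<in> topspace AXB_top" by (simp add: AXB_top_def)
  moreover have "equicontinuous AXB_top (double_orbit AXB f)"
    using f by (simp add: UCS_def)
  ultimately have "\<exists>U. openin AXB_top U \<and> (0, 1) \<in> U \<and>
      (\<forall>h\<in>double_orbit AXB f. \<forall>w\<in>U. norm (h w - h (0, 1)) < \<epsilon>)"
    using \<open>\<epsilon> > 0\<close> by (simp add: equicontinuous_def)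
  then obtain U where U: "openin AXB_top U" "(0, 1) \<in> U"
    and hU: "\<And>h w. h \<in> double_orbit AXB f \<Longrightarrow> w \<in> U \<Longrightarrow> norm (h w - h (0, 1)) < \<epsilon>"
    by blast
  have "open U"
    using U(1) openin_open_trans[of "UNIV \<times> {0<..}" U] by (simp add: AXB_top_def open_Times)
  then obtain A B where AB: "open A" "open B" "(0, 1) \<in> A \<times> B" "A \<times> B \<subseteq> U"
    using U(2) by (rule open_prod_elim)
  obtain e where e: "e > 0" "ball 0 e \<subseteq> A"
    using AB openE by blast
  have "e / 2 \<in> A" using e by (intro subsetD[OF e(2)]) (simp add: dist_real_def)
  then have "(e / 2, 1) \<in> U" using AB by blast
  then have "\<forall>h\<in>double_orbit AXB f. norm (h (e / 2, 1) - h (0, 1)) < \<epsilon>"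
    using hU by blast
  moreover have "e / 2 \<noteq> 0" using e(1) by simp
  ultimately show
    "\<exists>u v. u \<noteq> v \<and> (\<forall>h\<in>double_orbit AXB f. norm (h (u, 1) - h (v, 1)) < \<epsilon>)"
    by blast
qed

lemma WS_AXB_constant:
  assumes f: "f \<in> WS AXB AXB_top" and "a > 0"
  shows "f (s, a) = f (s', a)"
proof (rule constant_on_AXB_cosets[OF _ \<open>a > 0\<close>])
  fix \<epsilon> :: real assume "\<epsilon> > 0"
  obtain K where K: "compactin (weak_topology AXB_top) K" "double_orbit AXB f \<subseteq> K"
    using f unfolding WS_def relatively_weakly_compact_iff by blast
  have top: "(u, 1) \<in> topspace AXB_top" for u by (simp add: AXB_top_def)
  have cont: "continuous_on UNIV (\<lambda>u. h (u, 1))" if "h \<in> K" for h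
  proof -
    have "continuous_on (UNIV \<times> {0<..}) h"
      using that compactin_subset_topspace[OF K(1)] BC_continuous[of h AXB_top]
      by (auto simp: topspace_weak_topology AXB_top_def)
    then show ?thesis
      by (rule continuous_on_compose2) (auto intro!: continuous_intros)
  qed
  have ev: "continuous_map (weak_topology AXB_top) euclidean (\<lambda>h. h (u, 1))" for u
    by (rule continuous_map_weak_dual[OF evaluation_in_BC_dual[OF top]])
  have "\<exists>U. open U \<and> U \<noteq> {} \<and> (\<forall>h\<in>K. \<forall>u\<in>U. \<forall>v\<in>U. norm (h (u, 1) - h (v, 1)) < \<epsilon>)"
    by (rule compact_family_small_oscillation
        [where ev = "\<lambda>h u. h (u, 1)", OF K(1) ev cont \<open>\<epsilon> > 0\<close>]) assumption
  then obtain U where U: "open U" "U \<noteq> {}"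
    "\<And>h u v. h \<in> K \<Longrightarrow> u \<in> U \<Longrightarrow> v \<in> U \<Longrightarrow> norm (h (u, 1) - h (v, 1)) < \<epsilon>"
    by blast
  obtain u where u: "u \<in> U" using U(2) by blast
  have "U \<noteq> {u}" using U(1) not_open_singleton[of u] by auto
  then obtain v where v: "v \<in> U" "u \<noteq> v"
    using u by blast
  have "\<forall>h\<in>double_orbit AXB f. norm (h (u, 1) - h (v, 1)) < \<epsilon>"
    using U(3)[OF _ u v(1)] K(2) by blast
  then show "\<exists>u v. u \<noteq> v \<and> (\<forall>h\<in>double_orbit AXB f. norm (h (u, 1) - h (v, 1)) < \<epsilon>)"
    using v(2) by blast
qed

lemma comm_group_AXB_quot: "comm_group AXB_quot"
proof (rule group.group_comm_groupI)
  show grp: "group AXB_quot"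
    unfolding AXB_quot_def by (rule normal.factorgroup_is_group[OF normal_AXB_N])
  have hom: "AXB_quot_to_Rpos \<in> hom AXB_quot Rpos"
    and inj: "inj_on AXB_quot_to_Rpos (carrier AXB_quot)"
    using iso_AXB_quot_to_Rpos unfolding iso_def bij_betw_def by blast+
  fix x y assume xy: "x \<in> carrier AXB_quot" "y \<in> carrier AXB_quot"
  have "AXB_quot_to_Rpos (x \<otimes>\<^bsub>AXB_quot\<^esub> y) = AXB_quot_to_Rpos (y \<otimes>\<^bsub>AXB_quot\<^esub> x)"
    using hom_mult[OF hom xy] hom_mult[OF hom xy(2) xy(1)] by (simp add: mult.commute)
  then show "x \<otimes>\<^bsub>AXB_quot\<^esub> y = y \<otimes>\<^bsub>AXB_quot\<^esub> x"
    using xy grp by (intro inj_onD[OF inj]) (simp_all add: group.is_monoid monoid.m_closed)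
qed

lemma topspace_AXB_quot_top: "topspace AXB_quot_top = carrier AXB_quot"
proof -
  have "topspace AXB_quot_top = coset_map AXB AXB_N ` carrier AXB"
    by (simp add: AXB_quot_top_def topspace_quotient_topology AXB_top_def)
  also have "\<dots> = carrier AXB_quot"
    by (auto simp: AXB_quot_def FactGroup_def RCOSETS_def coset_map_def)
  finally show ?thesis .
qed

lemma WS_AXB:
  "WS AXB AXB_top =
    pullback_functions (carrier AXB) (coset_map AXB AXB_N) (WAP AXB_quot AXB_quot_top)"
proof
  let ?\<theta> = "coset_map AXB AXB_N"
  have top: "topspace AXB_top = carrier AXB" by (simp add: AXB_top_def)
  have gquot: "group AXB_quot"
    using comm_group_AXB_quot by (rule comm_group.axioms)
  have "?\<theta> \<in> hom AXB AXB_quot"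
    using normal.r_coset_hom_Mod[OF normal_AXB_N]
    by (simp add: AXB_quot_def coset_map_def[abs_def])
  moreover have "continuous_map AXB_top AXB_quot_top ?\<theta>"
    unfolding AXB_quot_top_def
    by (rule quotient_imp_continuous_map[OF quotient_map_quotient_topology])
  ultimately have "compose (carrier AXB) g ?\<theta> \<in> WS AXB AXB_top"
    if "g \<in> WAP AXB_quot AXB_quot_top" for g
    using WS_pullback[OF group_AXB top] WS_eq_WAP_if_comm[OF comm_group_AXB_quot] that
    by metis
  then show "pullback_functions (carrier AXB) ?\<theta> (WAP AXB_quot AXB_quot_top)
      \<subseteq> WS AXB AXB_top"
    unfolding pullback_functions_def by blast
  \<comment> \<open>The splitting homomorphism of the semidirect product.\<close>
  define \<sigma> where "\<sigma> K = (0 :: real, AXB_quot_to_Rpos K)" for K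
  have \<sigma>_hom: "\<sigma> \<in> hom AXB_quot AXB"
    using iso_AXB_quot_to_Rpos by (auto simp: \<sigma>_def iso_def hom_def)
  have \<sigma>_cont: "continuous_map AXB_quot_top AXB_top \<sigma>"
  proof -
    have "continuous_map AXB_quot_top Rpos_top AXB_quot_to_Rpos"
      by (rule homeomorphic_imp_continuous_map[OF homeomorphic_map_AXB_quot_to_Rpos])
    moreover have "continuous_map Rpos_top AXB_top (\<lambda>a. (0, a))"
      unfolding Rpos_top_def AXB_top_def
      by (auto simp: continuous_map_in_subtopology intro!: continuous_intros)
    ultimately have "continuous_map AXB_quot_top AXB_top ((\<lambda>a. (0, a)) \<circ> AXB_quot_to_Rpos)"
      by (rule continuous_map_compose)
    then show ?thesis by (simp add: \<sigma>_def[abs_def] o_def)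
  qed
  show "WS AXB AXB_top \<subseteq> pullback_functions (carrier AXB) ?\<theta> (WAP AXB_quot AXB_quot_top)"
  proof
    fix f assume f: "f \<in> WS AXB AXB_top"
    have f_ext: "f \<in> extensional (carrier AXB)"
      using f BC_extensional[of f AXB_top] top by (simp add: WS_def)
    have f_eq: "f z = compose (carrier AXB) (compose (carrier AXB_quot) f \<sigma>) ?\<theta> z"
      if z: "z \<in> carrier AXB" for z
    proof -
      obtain b a where ba: "z = (b, a)" "a > 0" using z by auto
      have mem: "UNIV \<times> {a} \<in> carrier AXB_quot"
        unfolding carrier_AXB_quot by (rule imageI) (simp add: ba(2))
      have "compose (carrier AXB) (compose (carrier AXB_quot) f \<sigma>) ?\<theta> z = f (\<sigma> (UNIV \<times> {a}))"
        using z mem by (simp only: compose_eq coset_map_AXB_N ba(1))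
      also have "\<dots> = f (0, a)"
        by (simp only: \<sigma>_def AXB_quot_to_Rpos_eq)
      also have "\<dots> = f (b, a)"
        by (rule WS_AXB_constant[OF f ba(2)])
      finally show ?thesis using ba(1) by simp
    qed
    have "f = compose (carrier AXB) (compose (carrier AXB_quot) f \<sigma>) ?\<theta>"
      by (rule extensionalityI[OF f_ext compose_extensional f_eq])
    moreover have "compose (carrier AXB_quot) f \<sigma> \<in> WAP AXB_quot AXB_quot_top"
      using WAP_pullback[OF gquot topspace_AXB_quot_top \<sigma>_hom \<sigma>_cont] f
        WS_subset_WAP[OF group_AXB] by blast
    ultimately show
      "f \<in> pullback_functions (carrier AXB) ?\<theta> (WAP AXB_quot AXB_quot_top)"
      unfolding pullback_functions_def by blast
  qed
qed

theorem theorem5p2: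
  shows "(\<forall>f \<in> UCS AXB AXB_top. \<forall>K \<in> rcosets\<^bsub>AXB\<^esub> AXB_N. f constant_on K) \<and>
    WS AXB AXB_top =
      pullback_functions (carrier AXB) (coset_map AXB AXB_N) (WAP AXB_quot AXB_quot_top) \<and>
    WAP AXB_quot AXB_quot_top =
      pullback_functions (carrier AXB_quot) AXB_quot_to_Rpos (WAP Rpos Rpos_top)"
proof (intro conjI ballI)
  fix f K assume f: "f \<in> UCS AXB AXB_top" and "K \<in> rcosets\<^bsub>AXB\<^esub> AXB_N"
  then obtain z where z: "z \<in> carrier AXB" "K = coset_map AXB AXB_N z"
    unfolding RCOSETS_def coset_map_def by blast
  obtain b a where "z = (b, a)" by (cases z)
  then have "a > 0" "K = UNIV \<times> {a}"
    using z by (simp_all add: coset_map_AXB_N)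
  then have "f y = f (0, a)" if "y \<in> K" for y
    using that UCS_AXB_constant[OF f \<open>a > 0\<close>, of "fst y" 0] by (cases y) simp
  then show "f constant_on K"
    unfolding constant_on_def by blast
next
  show "WS AXB AXB_top =
      pullback_functions (carrier AXB) (coset_map AXB AXB_N) (WAP AXB_quot AXB_quot_top)"
    by (rule WS_AXB)
next
  show "WAP AXB_quot AXB_quot_top =
      pullback_functions (carrier AXB_quot) AXB_quot_to_Rpos (WAP Rpos Rpos_top)"
    by (intro WAP_iso topspace_AXB_quot_top group_Rpos iso_AXB_quot_to_Rpos
        homeomorphic_map_AXB_quot_to_Rpos comm_group.axioms(2)[OF comm_group_AXB_quot])
      (simp add: Rpos_top_def)
qed

end
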